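(* Every tree $T$ with at least two vertices has $sn(T)=1$.
   Context: Graphs are finite, undirected and simple. Let $G=(V,E)$ be a connected graph with chromatic number $\chi(G)=k\ge 2$. For $S\subset V$, a partial coloring on $G[S]$ is a proper coloring $\mathscr C_0$ of the induced subgraph $G[S]$ with colors from $\{1,\dots,k\}$ (not all colors need be used). It is a Sudoku coloring of $G$ if there is exactly one proper $k$-coloring $V\to\{1,\dots,k\}$ of $G$ whose restriction to $S$ is $\mathscr C_0$. The Sudoku number $sn(G)$ is the smallest $|S|$ such that $G[S]$ admits a Sudoku coloring of $G$. *)

theory Defs
  imports "Graph_Theory.Digraph_Component" "HOL-Library.FuncSet"
begin

text \<open>
  A finite simple undirected graph is a digraph satisfying the locale predicate \<^locale>\<open>graph\<close>:
  finite, loop-free, without parallel arcs and symmetric, so that an undirected edge is a pair of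
  opposite arcs. Such a pair is already a \<^const>\<open>pre_digraph.cycle\<close> (of length 2); it is not a cycle
  of the undirected graph, so \<^const>\<open>tree\<close> from the library is not the undirected notion: it fails for
  every symmetric digraph with an arc. The cycles of the undirected graph are the cycles of length
  at least 3.
\<close>

definition undirected_cycle :: "('a, 'b) pre_digraph \<Rightarrow> 'b awalk \<Rightarrow> bool" where
  "undirected_cycle G p \<longleftrightarrow> pre_digraph.cycle G p \<and> 3 \<le> length p"

definition undirected_tree :: "('a, 'b) pre_digraph \<Rightarrow> bool" where
  "undirected_tree G \<longleftrightarrow> graph G \<and> connected G \<and> \<not> (\<exists>p. undirected_cycle G p)"

text \<open>
  Colorings are extensional functions, so that counting them (as in \<open>\<exists>!\<close> below) counts functions
  on the vertex set only.
\<close>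

definition proper_coloring :: "('a, 'b) pre_digraph \<Rightarrow> nat \<Rightarrow> ('a \<Rightarrow> nat) \<Rightarrow> bool" where
  "proper_coloring G k c \<longleftrightarrow>
     c \<in> verts G \<rightarrow>\<^sub>E {1..k} \<and> (\<forall>e \<in> arcs G. c (tail G e) \<noteq> c (head G e))"

definition chromatic_number :: "('a, 'b) pre_digraph \<Rightarrow> nat" where
  "chromatic_number G = (LEAST k. \<exists>c. proper_coloring G k c)"

definition partial_coloring :: "('a, 'b) pre_digraph \<Rightarrow> 'a set \<Rightarrow> ('a \<Rightarrow> nat) \<Rightarrow> bool" where
  "partial_coloring G S c0 \<longleftrightarrow> S \<subseteq> verts G \<and> proper_coloring (G \<restriction> S) (chromatic_number G) c0"

definition sudoku_coloring :: "('a, 'b) pre_digraph \<Rightarrow> 'a set \<Rightarrow> ('a \<Rightarrow> nat) \<Rightarrow> bool" where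
  "sudoku_coloring G S c0 \<longleftrightarrow> partial_coloring G S c0 \<and>
     (\<exists>!c. proper_coloring G (chromatic_number G) c \<and> restrict c S = c0)"

text \<open>
  Meaningful for connected \<open>G\<close> with chromatic number at least 2. The minimum is over a nonempty set,
  because \<open>S = verts G\<close> with any proper coloring is admissible.
\<close>

definition sudoku_number :: "('a, 'b) pre_digraph \<Rightarrow> nat" where
  "sudoku_number G = (LEAST n. \<exists>S c0. sudoku_coloring G S c0 \<and> card S = n)"

end

theory Submission
  imports Defs
begin

text \<open>
  A shortest odd closed walk is a cycle, so a forest has no odd closed walk, and the parity of
  walks from a root is a proper 2-coloring. In a connected graph the color of one vertex propagates
  along walks and determines a 2-coloring, so a single prescribed vertex suffices; the empty set
  does not, because swapping the two colors gives a second coloring.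
\<close>

text \<open>Strong induction on the length: a closed walk that revisits a vertex splits into two
  shorter closed walks, and since their lengths have an odd sum, one of them is odd.\<close>

lemma (in wf_digraph) odd_closed_awalk_imp_odd_cycle:
  assumes "awalk u p u" and "odd (length p)"
  shows "\<exists>c. cycle c \<and> odd (length c)"
  using assms
proof (induction "length p" arbitrary: p u rule: less_induct)
  case less
  show ?case
  proof (cases "distinct (tl (awalk_verts u p))")
    case True
    with less.prems have "cycle p" by (auto simp: cycle_def)
    with less.prems(2) show ?thesis by blast
  next
    case False
    \<comment> \<open>Removing the first arc matches the \<open>tl\<close> in \<open>cycle\<close>:
      the repeated vertex lies on the walk \<open>es\<close>, and any closed part of
      \<open>es\<close> is strictly shorter than \<open>p\<close>.\<close>
    obtain e es where p: "p = e # es" using less.prems(2) by (cases p) auto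
    with False less.prems(1) have es: "awalk (head G e) es u"
        "\<not> distinct (awalk_verts (head G e) es)" and e: "e \<in> arcs G" "tail G e = u"
      by (auto simp: awalk_Cons_iff)
    from awalk_not_distinct_decomp[OF es] obtain q r s a b w where
      dec: "es = q @ r @ s" "0 < length r" "awalk a q w" "awalk w r w" "awalk w s b"
      by blast
    show ?thesis
    proof (cases "odd (length r)")
      case True
      with less.hyps[of r w] dec p show ?thesis by auto
    next
      case even: False
      \<comment> \<open>Since \<open>r\<close> is closed, cutting it out keeps the ends of the walk;
        since it is even, the rest of \<open>p\<close> stays odd.\<close>
      have "awalk (head G e) (q @ s) u"
        using es(1) dec by (auto dest!: awalk_ends_eqD)
      with e have "awalk u (e # q @ s) u" by (auto simp: awalk_Cons_iff)
      moreover have "odd (length (e # q @ s))" using less.prems(2) p dec even by auto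
      ultimately show ?thesis using less.hyps[of "e # q @ s" u] p dec by auto
    qed
  qed
qed

text \<open>Length 1 would be a loop, and odd length excludes 2, the pair of opposite arcs of one
  edge.\<close>

lemma (in loopfree_digraph) odd_cycle_imp_undirected_cycle:
  assumes "cycle p" and "odd (length p)"
  shows "undirected_cycle G p"
proof -
  have "length p \<noteq> 1"
    using assms(1) by (auto dest: no_loops[THEN not_sym] simp: cycle_def length_Suc_conv awalk_Cons_iff awalk_Nil_iff)
  with assms(2) have "3 \<le> length p" by presburger
  with assms(1) show ?thesis by (simp add: undirected_cycle_def)
qed

lemma (in wf_digraph) strongly_connected_two_coloring:
  assumes "strongly_connected G"
    and even_closed: "\<And>u p. awalk u p u \<Longrightarrow> even (length p)"
  shows "\<exists>c. proper_coloring G 2 c"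
proof -
  obtain r where r: "r \<in> verts G" using assms(1) by (auto simp: strongly_connected_def)
  have "\<forall>v\<in>verts G. \<exists>p. awalk r p v"
    using assms(1) r by (auto simp: strongly_connected_def reachable_awalk)
  then obtain P where P: "\<And>v. v \<in> verts G \<Longrightarrow> awalk r (P v) v" by metis
  \<comment> \<open>Evenness is known for closed walks only, so walks from \<open>r\<close> are
    compared after closing them with a common return walk.\<close>
  have "\<forall>v\<in>verts G. \<exists>p. awalk v p r"
    using assms(1) r by (auto simp: strongly_connected_def reachable_awalk)
  then obtain Q where Q: "\<And>v. v \<in> verts G \<Longrightarrow> awalk v (Q v) r" by metis
  define c where "c = restrict (\<lambda>v. if even (length (P v)) then 1 else 2 :: nat) (verts G)"
  have "c (tail G e) \<noteq> c (head G e)" if e: "e \<in> arcs G" for e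
  proof -
    have v: "tail G e \<in> verts G" "head G e \<in> verts G" using e by auto
    \<comment> \<open>This closed walk and \<open>P (head G e) @ Q (head G e)\<close> are both even
      and share the return part, so the single arc \<open>e\<close> makes the parities of the two
      outgoing walks differ.\<close>
    have "awalk r (P (tail G e) @ e # Q (head G e)) r"
      using P[OF v(1)] Q[OF v(2)] e v by (auto intro!: awalk_appendI simp: awalk_Cons_iff)
    from even_closed[OF this] even_closed[OF awalk_appendI[OF P[OF v(2)] Q[OF v(2)]]]
    have "even (length (P (tail G e))) \<noteq> even (length (P (head G e)))" by simp
    then show ?thesis using v by (auto simp: c_def)
  qed
  then have "proper_coloring G 2 c" by (auto simp: proper_coloring_def c_def)
  then show ?thesis by blast
qed

lemma proper_coloring_less_2_imp_arcs_empty: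
  assumes "wf_digraph G" and "proper_coloring G k c" and "k < 2"
  shows "arcs G = {}"
proof (rule ccontr)
  interpret wf_digraph G by fact
  assume "arcs G \<noteq> {}"
  then obtain e where e: "e \<in> arcs G" by blast
  then have "c (tail G e) \<in> {1..k}" "c (head G e) \<in> {1..k}"
    using assms(2) by (auto simp: proper_coloring_def)
  \<comment> \<open>\<open>{1..k}\<close> is empty for \<open>k = 0\<close> and a singleton for
    \<open>k = 1\<close>.\<close>
  with assms(3) have "c (tail G e) = c (head G e)" by auto
  with e assms(2) show False by (auto simp: proper_coloring_def)
qed

lemma (in wf_digraph) strongly_connected_imp_arcs_nonempty:
  assumes "strongly_connected G" and "card (verts G) \<ge> 2"
  shows "arcs G \<noteq> {}"
proof
  assume no_arcs: "arcs G = {}"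
  obtain u v where uv: "u \<in> verts G" "v \<in> verts G" "u \<noteq> v"
    using assms(2) by (metis card_le_Suc0_iff_eq card.infinite not_less_eq_eq numeral_2_eq_2 zero_le)
  then obtain p where "awalk u p v"
    using assms(1) by (auto simp: strongly_connected_def reachable_awalk)
  with no_arcs uv show False by (auto simp: awalk_def)
qed

text \<open>Induction along a walk from \<open>r\<close>: with two colors, the head of an arc must
  take the color that its tail does not have.\<close>

lemma (in wf_digraph) two_colorings_eqI:
  assumes "strongly_connected G" and c: "proper_coloring G 2 c" and d: "proper_coloring G 2 d"
    and "r \<in> verts G" and "c r = d r"
  shows "c = d"
proof (rule PiE_ext)
  show "c \<in> verts G \<rightarrow>\<^sub>E {1..2}" "d \<in> verts G \<rightarrow>\<^sub>E {1..2}"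
    using c d by (auto simp: proper_coloring_def)
  fix v assume "v \<in> verts G"
  with assms have "r \<rightarrow>\<^sup>* v" by (auto simp: strongly_connected_def)
  then show "c v = d v"
  proof (induction rule: reachable_induct)
    case base
    show ?case by fact
  next
    case (step x y)
    obtain e where e: "e \<in> arcs G" "tail G e = x" "head G e = y"
      using step.hyps(2) by (auto simp: arcs_ends_def arc_to_ends_def)
    have ends: "f x \<in> {1..2} \<and> f y \<in> {1..2} \<and> f x \<noteq> f y" if "proper_coloring G 2 f" for f
      using that e by (auto simp: proper_coloring_def PiE_iff)
    show ?case using ends[OF c] ends[OF d] step.IH by auto
  qed
qed

lemma proper_coloring_induce_subgraph:
  assumes "proper_coloring G k c" and "S \<subseteq> verts G"
  shows "proper_coloring (G \<restriction> S) k (restrict c S)"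
  using assms by (auto simp: proper_coloring_def)

lemma (in wf_digraph) chromatic_number_eq_2:
  assumes "proper_coloring G 2 c" and "arcs G \<noteq> {}"
  shows "chromatic_number G = 2"
  unfolding chromatic_number_def
proof (rule Least_equality)
  show "\<exists>c. proper_coloring G 2 c" using assms(1) by blast
  show "2 \<le> k" if "\<exists>c. proper_coloring G k c" for k
    using that assms(2) proper_coloring_less_2_imp_arcs_empty[OF wf_digraph_axioms]
    by (meson not_le)
qed

text \<open>The map \<open>3 - _\<close> exchanges the colors 1 and 2; this supplies the second
  coloring that rules out the empty set.\<close>

lemma (in wf_digraph) swap_two_coloring:
  assumes "proper_coloring G 2 c"
  shows "proper_coloring G 2 (\<lambda>v\<in>verts G. 3 - c v)"
proof -
  have c: "c v \<in> {1..2}" if "v \<in> verts G" for v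
    using assms that by (auto simp: proper_coloring_def)
  have "3 - c (tail G e) \<noteq> 3 - c (head G e)" if "e \<in> arcs G" for e
    using c[OF tail_in_verts[OF that]] c[OF head_in_verts[OF that]] that assms
    by (auto simp: proper_coloring_def)
  moreover have "3 - c v \<in> {1..2}" if "v \<in> verts G" for v using c[OF that] by auto
  ultimately show ?thesis by (auto simp: proper_coloring_def)
qed

text \<open>Any vertex \<open>r\<close>, with its color under \<open>c\<close>, attains the bound;
  for minimality only size 0 has to be excluded.\<close>

lemma (in fin_digraph) sudoku_number_eq_1:
  assumes sc: "strongly_connected G" and chi: "chromatic_number G = 2"
    and c: "proper_coloring G 2 c"
  shows "sudoku_number G = 1"
  unfolding sudoku_number_def
proof (rule Least_equality)
  obtain r where r: "r \<in> verts G" using sc by (auto simp: strongly_connected_def)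
  have "d = c" if "proper_coloring G 2 d" "restrict d {r} = restrict c {r}" for d
    using two_colorings_eqI[OF sc that(1) c r] fun_cong[OF that(2), of r] by simp
  then have "sudoku_coloring G {r} (restrict c {r})"
    using r c proper_coloring_induce_subgraph[OF c, of "{r}"]
    by (auto simp: sudoku_coloring_def partial_coloring_def chi)
  then show "\<exists>S c0. sudoku_coloring G S c0 \<and> card S = 1" by force
  fix n assume "\<exists>S c0. sudoku_coloring G S c0 \<and> card S = n"
  then obtain S c0 where S: "sudoku_coloring G S c0" "card S = n" by blast
  show "1 \<le> n"
  proof (rule ccontr)
    assume "\<not> 1 \<le> n"
    \<comment> \<open>\<open>card\<close> is 0 on infinite sets as well, so finiteness is what turns
      size 0 into the empty set.\<close>
    moreover have "finite S"
      using S(1) finite_subset[OF _ finite_verts] by (auto simp: sudoku_coloring_def partial_coloring_def)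
    ultimately have "S = {}" using S(2) by (simp add: not_le)
    with S(1) have uniq: "\<exists>!c. proper_coloring G 2 c \<and> restrict c {} = c0"
      by (simp add: sudoku_coloring_def chi)
    \<comment> \<open>Restricted to the empty set, every function is constantly
      \<open>undefined\<close>, so \<open>c\<close> and its swap both extend
      \<open>c0\<close>.\<close>
    have "restrict f {} = restrict g {}" for f g :: "'a \<Rightarrow> nat"
      by (simp add: restrict_def)
    with uniq c swap_two_coloring[OF c] have "c = (\<lambda>v\<in>verts G. 3 - c v)" by metis
    then have "c r = 3 - c r" using r by (metis restrict_apply')
    moreover have "c r \<in> {1..2}" using c r by (auto simp: proper_coloring_def)
    ultimately show False unfolding atLeastAtMost_iff by presburger
  qed
qed

theorem corollary3p2:
  fixes T :: "('a, 'b) pre_digraph"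
  assumes "undirected_tree T" and "card (verts T) \<ge> 2"
  shows "sudoku_number T = 1"
proof -
  interpret graph T using assms(1) by (simp add: undirected_tree_def)
  \<comment> \<open>Arcs come in opposite pairs, so connectedness provides directed walks both
    ways.\<close>
  have sc: "strongly_connected T"
    using assms(1) sym_arcs
    by (auto simp: undirected_tree_def intro: symmetric_connected_imp_strongly_connected)
  have "even (length p)" if "awalk u p u" for u p
    using odd_closed_awalk_imp_odd_cycle[OF that] odd_cycle_imp_undirected_cycle assms(1)
    by (auto simp: undirected_tree_def)
  with sc obtain c where c: "proper_coloring T 2 c"
    using strongly_connected_two_coloring by blast
  \<comment> \<open>A walk between two distinct vertices contains an arc, which excludes fewer than
    two colors.\<close>
  moreover have "chromatic_number T = 2"
    using c strongly_connected_imp_arcs_nonempty[OF sc assms(2)] by (rule chromatic_number_eq_2)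
  ultimately show ?thesis using sc by (intro sudoku_number_eq_1)
qed

end
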